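(* Let $\mathbb{F}$ be an algebraically closed field of characteristic $p\ge 0$ and let $A$ be an infinite (countable) dimensional simple locally finite associative algebra over $\mathbb{F}$. Then $A$ possesses a $1$-perfect local system.
   Context: Algebras are associative and not required to have an identity element; ideals are two-sided. An algebra $A$ over $\mathbb{F}$ is locally finite if every finite set of elements of $A$ is contained in a finite dimensional subalgebra of $A$. A local system for $A$ is a system $\{A_\alpha\}_{\alpha\in\Gamma}$ of finite dimensional subalgebras of $A$ such that $A=\bigcup_{\alpha\in\Gamma}A_\alpha$ and for all $\alpha,\beta\in\Gamma$ there is $\gamma\in\Gamma$ with $A_\alpha,A_\beta\subseteq A_\gamma$. An associative algebra is $1$-perfect if it has no ideals of codimension $1$. A local system is $1$-perfect if each of its members is a $1$-perfect algebra. *)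

theory Defs
  imports
    "HOL-Computational_Algebra.Computational_Algebra"
    "HOL-Library.Countable_Set"
begin

text \<open>
  Associative algebras over a field, not necessarily with an identity element: the class
  \<open>ring\<close> has no unit. All notions below are stated for a subset \<open>B\<close> of the ambient algebra which
  is meant to be a subalgebra; the whole algebra is the case \<open>B = UNIV\<close>.
\<close>

locale assoc_algebra = vector_space scale
  for scale :: "'k::field \<Rightarrow> 'a::ring \<Rightarrow> 'a" (infixr \<open>*s\<close> 75) +
  assumes scale_mult_left: "(c *s x) * y = c *s (x * y)"
    and scale_mult_right: "x * (c *s y) = c *s (x * y)"
begin

definition subalgebra :: "'a set \<Rightarrow> bool" where
  "subalgebra B \<longleftrightarrow> subspace B \<and> (\<forall>x\<in>B. \<forall>y\<in>B. x * y \<in> B)"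

definition ideal_of :: "'a set \<Rightarrow> 'a set \<Rightarrow> bool" where
  "ideal_of I B \<longleftrightarrow> subspace I \<and> I \<subseteq> B \<and> (\<forall>b\<in>B. \<forall>x\<in>I. b * x \<in> I \<and> x * b \<in> I)"

definition finite_dim :: "'a set \<Rightarrow> bool" where
  "finite_dim V \<longleftrightarrow> (\<exists>S. finite S \<and> independent S \<and> span S = V)"

definition countably_infinite_dim :: "'a set \<Rightarrow> bool" where
  "countably_infinite_dim V \<longleftrightarrow>
     (\<exists>S. countable S \<and> infinite S \<and> independent S \<and> span S = V)"

text \<open>
  \<open>has_codim I V n\<close> says that \<open>dim (V / I) = n\<close> for subspaces \<open>I \<subseteq> V\<close>: the \<open>n\<close> elements of \<open>S\<close>
  represent a basis of the quotient space. The last conjunct (linear independence modulo \<open>I\<close>)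
  also forces distinct elements of \<open>S\<close> to have distinct cosets.
\<close>

definition has_codim :: "'a set \<Rightarrow> 'a set \<Rightarrow> nat \<Rightarrow> bool" where
  "has_codim I V n \<longleftrightarrow>
     (\<exists>S. S \<subseteq> V \<and> finite S \<and> card S = n \<and> span (I \<union> S) = V \<and>
        (\<forall>u. (\<Sum>v\<in>S. u v *s v) \<in> I \<longrightarrow> (\<forall>v\<in>S. u v = 0)))"

text \<open>As usual, algebras with zero multiplication do not count as simple.\<close>

definition simple_algebra :: "'a set \<Rightarrow> bool" where
  "simple_algebra B \<longleftrightarrow>
     subalgebra B \<and> (\<exists>x\<in>B. \<exists>y\<in>B. x * y \<noteq> 0) \<and> (\<forall>I. ideal_of I B \<longrightarrow> I = {0} \<or> I = B)"

definition locally_finite :: "'a set \<Rightarrow> bool" where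
  "locally_finite B \<longleftrightarrow>
     (\<forall>X. finite X \<and> X \<subseteq> B \<longrightarrow>
        (\<exists>C. subalgebra C \<and> finite_dim C \<and> C \<subseteq> B \<and> X \<subseteq> C))"

definition local_system :: "'a set set \<Rightarrow> 'a set \<Rightarrow> bool" where
  "local_system \<C> B \<longleftrightarrow>
     (\<forall>C\<in>\<C>. subalgebra C \<and> finite_dim C \<and> C \<subseteq> B) \<and>
     B = \<Union>\<C> \<and>
     (\<forall>C\<in>\<C>. \<forall>D\<in>\<C>. \<exists>E\<in>\<C>. C \<subseteq> E \<and> D \<subseteq> E)"

definition one_perfect :: "'a set \<Rightarrow> bool" where
  "one_perfect B \<longleftrightarrow> \<not> (\<exists>I. ideal_of I B \<and> has_codim I B 1)"

definition one_perfect_local_system :: "'a set set \<Rightarrow> 'a set \<Rightarrow> bool" where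
  "one_perfect_local_system \<C> B \<longleftrightarrow> local_system \<C> B \<and> (\<forall>C\<in>\<C>. one_perfect C)"

end

end

theory Submission
  imports Defs
begin

text \<open>
  Every finite dimensional algebra \<open>B\<close> has a greatest 1-perfect subalgebra: descend through ideals of
  codimension 1 as long as possible. It is an ideal of \<open>B\<close>, so the union of all finite dimensional
  1-perfect subalgebras of \<open>A\<close> is a directed union and an ideal of \<open>A\<close>; by simplicity it is \<open>A\<close> or \<open>0\<close>.
  If it is \<open>0\<close>, every finite dimensional subalgebra has a chain of successive ideals of codimension 1
  that ends in \<open>0\<close>, and then its nilpotent elements form an ideal containing all commutators; hence so
  do the nilpotent elements of \<open>A\<close>. If all of \<open>A\<close> is nil, then \<open>x \<in> AxA\<close> for some \<open>x \<noteq> 0\<close> contradicts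
  the existence of these chains. Otherwise \<open>A\<close> is a commutative domain, and its finite dimensional
  subalgebras are at most one-dimensional, as a nonzero ideal of such a domain is never proper.
\<close>

text \<open>Nilpotency by repeated squaring, as a ring without identity has no power operation.\<close>

inductive nil :: "'a::ring \<Rightarrow> bool" where
  nil_zero: "nil 0"
| nil_square: "nil (z * z) \<Longrightarrow> nil z"

context assoc_algebra
begin

section \<open>Ideals of codimension 1 and descent along them\<close>

lemma ideal_ofD:
  assumes "ideal_of I B"
  shows "subspace I" "I \<subseteq> B" "\<And>b x. b \<in> B \<Longrightarrow> x \<in> I \<Longrightarrow> b * x \<in> I"
    "\<And>b x. b \<in> B \<Longrightarrow> x \<in> I \<Longrightarrow> x * b \<in> I"
  using assms by (auto simp: ideal_of_def)

lemma subalgebraD: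
  assumes "subalgebra B"
  shows "subspace B" "\<And>x y. x \<in> B \<Longrightarrow> y \<in> B \<Longrightarrow> x * y \<in> B"
  using assms by (auto simp: subalgebra_def)

lemma ideal_imp_subalgebra: "ideal_of I B \<Longrightarrow> subalgebra I"
  by (auto simp: ideal_of_def subalgebra_def)

lemma has_codim_1_iff:
  assumes "subspace I" "subspace B" "I \<subseteq> B"
  shows "has_codim I B 1 \<longleftrightarrow> (\<exists>v\<in>B. v \<notin> I \<and> (\<forall>x\<in>B. \<exists>c. x - c *s v \<in> I))"
proof
  assume "has_codim I B 1"
  then obtain v where v: "v \<in> B" "span (insert v I) = B"
    and ind: "\<And>u::'a \<Rightarrow> 'k. u v *s v \<in> I \<Longrightarrow> u v = 0"
    unfolding has_codim_def by (auto simp: card_1_singleton_iff)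
  have "v \<notin> I" using ind[of "\<lambda>_. 1"] by auto
  moreover have "\<exists>c. x - c *s v \<in> I" if "x \<in> B" for x
    using that v(2) span_insert[of v I] span_eq_iff[THEN iffD2, OF assms(1)] by auto
  ultimately show "\<exists>v\<in>B. v \<notin> I \<and> (\<forall>x\<in>B. \<exists>c. x - c *s v \<in> I)" using v by blast
next
  assume "\<exists>v\<in>B. v \<notin> I \<and> (\<forall>x\<in>B. \<exists>c. x - c *s v \<in> I)"
  then obtain v where v: "v \<in> B" "v \<notin> I" "\<And>x. x \<in> B \<Longrightarrow> \<exists>c. x - c *s v \<in> I" by blast
  have "span (insert v I) = B"
  proof
    show "span (insert v I) \<subseteq> B" using v assms by (intro span_minimal) auto
    show "B \<subseteq> span (insert v I)" using v(3) span_insert[of v I] span_eq_iff[THEN iffD2, OF assms(1)] by auto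
  qed
  moreover have "c = 0" if "c *s v \<in> I" for c
  proof (rule ccontr)
    assume "c \<noteq> 0"
    then have "v = inverse c *s (c *s v)" by simp
    then show False using v(2) subspace_scale[OF assms(1) that, of "inverse c"] by simp
  qed
  ultimately show "has_codim I B 1"
    unfolding has_codim_def using v(1) by (intro exI[of _ "{v}"]) auto
qed

lemma codim_1E:
  assumes "ideal_of I B" "subspace B" "has_codim I B 1"
  obtains v where "v \<in> B" "v \<notin> I" "\<And>x. x \<in> B \<Longrightarrow> \<exists>c. x - c *s v \<in> I"
  using has_codim_1_iff[of I B] ideal_ofD[OF assms(1)] assms by blast

text \<open>Any \<open>w\<close> outside \<open>I\<close> is a nonzero multiple of the given
  representative \<open>v\<close> modulo \<open>I\<close>, so it represents a basis of the quotient
  equally well. Later proofs can thus choose the complement that suits them.\<close>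

lemma codim_1_complement:
  assumes "ideal_of I B" "subspace B" "has_codim I B 1" "w \<in> B" "w \<notin> I" "x \<in> B"
  obtains c i where "i \<in> I" "x = i + c *s w"
proof -
  note sI = ideal_ofD(1)[OF assms(1)]
  obtain v where v: "v \<in> B" "v \<notin> I" "\<And>x. x \<in> B \<Longrightarrow> \<exists>c. x - c *s v \<in> I"
    using codim_1E[OF assms(1-3)] by blast
  obtain d where d: "w - d *s v \<in> I" using v(3) assms(4) by blast
  obtain e where e: "x - e *s v \<in> I" using v(3) assms(6) by blast
  have "d \<noteq> 0" using d assms(5) by auto
  then have "x - (e / d) *s w = (x - e *s v) - (e / d) *s (w - d *s v)"
    by (simp add: scale_right_diff_distrib)
  then have "x - (e / d) *s w \<in> I"
    using subspace_diff[OF sI e subspace_scale[OF sI d, of "e / d"]] by metis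
  then show thesis using that[of "x - (e / d) *s w" "e / d"] by simp
qed

text \<open>This is the descent through ideals of codimension 1 as an induction rule. It terminates
  because a basis \<open>T\<close> of \<open>I\<close> together with some \<open>v\<close> outside
  \<open>I\<close> is independent in \<open>span S\<close>, so \<open>I\<close> has a strictly
  smaller basis than \<open>B\<close>.\<close>

lemma finite_dim_codim_1_induct [consumes 2, case_names perfect step]:
  assumes "subalgebra B" "finite_dim B"
    and perfect: "\<And>B. subalgebra B \<Longrightarrow> finite_dim B \<Longrightarrow> one_perfect B \<Longrightarrow> Q B"
    and step: "\<And>B I. subalgebra B \<Longrightarrow> finite_dim B \<Longrightarrow> ideal_of I B \<Longrightarrow> has_codim I B 1
      \<Longrightarrow> Q I \<Longrightarrow> Q B"
  shows "Q B"
proof -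
  have "\<forall>B. subalgebra B \<and> span S = B \<longrightarrow> Q B" if "finite S" "independent S" for S
    using that
  proof (induction "card S" arbitrary: S rule: less_induct)
    case less
    show ?case
    proof (intro allI impI)
      fix B assume B: "subalgebra B \<and> span S = B"
      then have fd: "finite_dim B" using less.prems by (auto simp: finite_dim_def)
      show "Q B"
      proof (cases "one_perfect B")
        case True
        then show ?thesis using perfect[OF conjunct1[OF B] fd] by simp
      next
        case False
        then obtain I where I: "ideal_of I B" "has_codim I B 1" by (auto simp: one_perfect_def)
        obtain v where v: "v \<in> B" "v \<notin> I" using codim_1E[OF I(1) subalgebraD(1) I(2)] B by blast
        obtain T where T: "T \<subseteq> I" "independent T" "I \<subseteq> span T"
          using maximal_independent_subset[of I] by blast
        have IT: "span T = I" using span_subspace[OF T(1,3) ideal_ofD(1)[OF I(1)]] .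
        have "independent (insert v T)" using T v IT by (simp add: independent_insertI)
        moreover have "insert v T \<subseteq> span S" using T v B ideal_ofD(2)[OF I(1)] by auto
        ultimately have "finite (insert v T) \<and> card (insert v T) \<le> card S"
          by (rule independent_span_bound[OF less.prems(1)])
        moreover have "v \<notin> T" using v T by blast
        ultimately have "finite T" "card T < card S" by auto
        then have "Q I" using less.hyps[OF _ _ T(2)] IT ideal_imp_subalgebra[OF I(1)] by simp
        then show ?thesis using step[OF conjunct1[OF B] fd I] by simp
      qed
    qed
  qed
  then show ?thesis using assms(1,2) by (auto simp: finite_dim_def)
qed

section \<open>The greatest 1-perfect subalgebra\<close>

text \<open>A subspace that contains all products is automatically an ideal. If the products did not
  span \<open>P\<close>, a basis of their span could be extended to a basis of \<open>P\<close>, and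
  dropping one new vector \<open>v\<close> would leave an ideal of codimension 1.\<close>

lemma one_perfect_square:
  assumes P: "subalgebra P" "one_perfect P"
  shows "P \<subseteq> span {x * y |x y. x \<in> P \<and> y \<in> P}" (is "P \<subseteq> span ?Q")
proof (rule ccontr)
  assume ne: "\<not> P \<subseteq> span ?Q"
  note sP = subalgebraD[OF P(1)]
  have QP: "span ?Q \<subseteq> P" using sP by (intro span_minimal) auto
  obtain T where T: "T \<subseteq> span ?Q" "independent T" "span ?Q \<subseteq> span T"
    using maximal_independent_subset[of "span ?Q"] by blast
  obtain T' where T': "T \<subseteq> T'" "T' \<subseteq> P" "independent T'" "P \<subseteq> span T'"
    using maximal_independent_subset_extend[OF _ T(2), of P] T(1) QP by blast
  have "T' \<noteq> T" using T' T ne span_minimal[OF T(1)] by auto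
  then obtain v where v: "v \<in> T'" "v \<notin> T" using T' by blast
  define I where "I = span (T' - {v})"
  have IP: "I \<subseteq> P" unfolding I_def using T' sP by (intro span_minimal) auto
  have "?Q \<subseteq> I" using T(3) span_mono[of T "T' - {v}"] v T' span_superset[of ?Q] unfolding I_def by blast
  then have id: "ideal_of I P" using IP unfolding ideal_of_def I_def by auto
  have vI: "v \<notin> I" using v T' unfolding I_def dependent_def by auto
  have "\<exists>c. x - c *s v \<in> I" if "x \<in> P" for x
    using that T'(4) v span_insert[of v "T' - {v}"] unfolding I_def by (auto simp: insert_absorb)
  then have "has_codim I P 1"
    using has_codim_1_iff[of I P] id sP v T' vI unfolding ideal_of_def by blast
  then show False using P(2) id by (auto simp: one_perfect_def)
qed

text \<open>Otherwise \<open>C \<inter> I\<close> would be an ideal of codimension 1 in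
  \<open>C\<close>, with any \<open>w\<close> in \<open>C\<close> outside \<open>I\<close> as
  complement.\<close>

lemma one_perfect_subset_codim_1:
  assumes "ideal_of I B" "subspace B" "has_codim I B 1" "C \<subseteq> B" "subalgebra C" "one_perfect C"
  shows "C \<subseteq> I"
proof
  fix w assume w: "w \<in> C"
  show "w \<in> I"
  proof (rule ccontr)
    assume wI: "w \<notin> I"
    note sC = subalgebraD[OF assms(5)] and sI = ideal_ofD[OF assms(1)]
    have id: "ideal_of (C \<inter> I) C"
      using sC sI assms(4) by (auto simp: ideal_of_def subspace_inter)
    have "\<exists>c. x - c *s w \<in> C \<inter> I" if x: "x \<in> C" for x
    proof -
      obtain c i where "i \<in> I" "x = i + c *s w"
        using codim_1_complement[OF assms(1-3) _ wI] w x assms(4) by blast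
      then have "x - c *s w \<in> I" by simp
      moreover have "x - c *s w \<in> C" using sC x w by (simp add: subspace_diff subspace_scale)
      ultimately show ?thesis by blast
    qed
    then have "has_codim (C \<inter> I) C 1"
      using has_codim_1_iff[of "C \<inter> I" C] id sC w wI unfolding ideal_of_def by blast
    then show False using assms(6) id by (auto simp: one_perfect_def)
  qed
qed

text \<open>Ideals of ideals need not be ideals; for a 1-perfect \<open>P\<close> this is repaired by
  \<open>P = P\<^sup>2\<close>, since then \<open>BP = (BP)P \<subseteq> IP \<subseteq> P\<close>.\<close>

lemma one_perfect_ideal_trans:
  assumes P: "ideal_of P I" "one_perfect P" and I: "ideal_of I B"
  shows "ideal_of P B"
proof -
  note sP = ideal_ofD[OF P(1)] and sI = ideal_ofD[OF I]
  have gen: "P \<subseteq> span {x * y |x y. x \<in> P \<and> y \<in> P}"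
    using one_perfect_square[OF ideal_imp_subalgebra[OF P(1)] P(2)] .
  have "b * x \<in> P \<and> x * b \<in> P" if b: "b \<in> B" and "x \<in> P" for b x
  proof -
    have "x \<in> span {x * y |x y. x \<in> P \<and> y \<in> P}" using gen that by blast
    then show ?thesis
    proof (induction rule: span_induct_alt)
      case base
      then show ?case using subspace_0[OF sP(1)] by simp
    next
      case (step c z y)
      then obtain p q where pq: "z = p * q" "p \<in> P" "q \<in> P" by blast
      have "b * z \<in> P" using sP(3)[of "b * p" q] sI(2,3) sP(2) pq b by (auto simp: mult.assoc)
      moreover have "z * b \<in> P"
        using sP(4)[of "q * b" p] sI(4) sP(2) pq b by (auto simp: mult.assoc)
      ultimately show ?case using step sP(1)
        by (simp add: distrib_left distrib_right scale_mult_left scale_mult_right subspace_add subspace_scale)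
    qed
  qed
  then show ?thesis using sP sI by (auto simp: ideal_of_def)
qed

lemma ideal_of_refl: "subalgebra B \<Longrightarrow> ideal_of B B"
  by (auto simp: ideal_of_def subalgebra_def)

text \<open>Passing from \<open>B\<close> to an ideal \<open>I\<close> of codimension 1 loses no
  1-perfect subalgebra, so the greatest one of \<open>I\<close> also serves for \<open>B\<close>. It
  remains an ideal by \<open>one_perfect_ideal_trans\<close>.\<close>

lemma greatest_one_perfect:
  assumes "subalgebra B" "finite_dim B"
  obtains P where "ideal_of P B" "finite_dim P" "one_perfect P"
    "\<And>C. C \<subseteq> B \<Longrightarrow> subalgebra C \<Longrightarrow> one_perfect C \<Longrightarrow> C \<subseteq> P"
proof -
  have "\<exists>P. ideal_of P B \<and> finite_dim P \<and> one_perfect P \<and>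
      (\<forall>C. C \<subseteq> B \<and> subalgebra C \<and> one_perfect C \<longrightarrow> C \<subseteq> P)"
    using assms
  proof (induction rule: finite_dim_codim_1_induct)
    case perfect
    then show ?case using ideal_of_refl by blast
  next
    case (step B I)
    then obtain P where P: "ideal_of P I" "finite_dim P" "one_perfect P"
      "\<And>C. C \<subseteq> I \<Longrightarrow> subalgebra C \<Longrightarrow> one_perfect C \<Longrightarrow> C \<subseteq> P" by blast
    have "C \<subseteq> P" if "C \<subseteq> B" "subalgebra C" "one_perfect C" for C
      using P(4) one_perfect_subset_codim_1[OF step(3) _ step(4)] subalgebraD(1)[OF step(1)] that by blast
    then show ?case using P one_perfect_ideal_trans[OF P(1,3) step(3)] by blast
  qed
  then show thesis using that by blast
qed

section \<open>Nil elements along chains of ideals of codimension 1\<close>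

text \<open>For a subalgebra \<open>B\<close>, this says that factoring out the nil elements makes
  sense and leaves a commutative algebra without nonzero nilpotents.\<close>

definition nil_ideal :: "'a set \<Rightarrow> bool" where
  "nil_ideal B \<longleftrightarrow> ideal_of {z \<in> B. nil z} B \<and> (\<forall>x\<in>B. \<forall>y\<in>B. nil (x * y - y * x))"

lemma nil_in_radical:
  assumes "nil z" "z \<in> B" "subalgebra B" "0 \<in> N"
    and "\<And>z. z \<in> B \<Longrightarrow> z * z \<in> N \<Longrightarrow> z \<in> N"
  shows "z \<in> N"
  using assms(1,2)
proof induction
  case nil_zero
  then show ?case using assms by simp
next
  case (nil_square z)
  then show ?case using subalgebraD(2)[OF assms(3)] assms(5) by blast
qed

text \<open>By \<open>red\<close>, the ideal \<open>N\<close> absorbs every nil element of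
  \<open>B\<close>, hence it is exactly the set of nil elements.\<close>

lemma nil_idealI:
  assumes B: "subalgebra B" and N: "ideal_of N B" and nil: "\<And>z. z \<in> N \<Longrightarrow> nil z"
    and red: "\<And>z. z \<in> B \<Longrightarrow> z * z \<in> N \<Longrightarrow> z \<in> N"
    and comm: "\<And>x y. x \<in> B \<Longrightarrow> y \<in> B \<Longrightarrow> x * y - y * x \<in> N"
  shows "nil_ideal B"
proof -
  have "{z \<in> B. nil z} = N"
    using nil_in_radical[OF _ _ B subspace_0[OF ideal_ofD(1)[OF N]] red] ideal_ofD(2)[OF N] nil
    by blast
  then show ?thesis using N comm nil by (auto simp: nil_ideal_def)
qed

text \<open>The nil part \<open>N\<close> of \<open>I\<close> is an ideal of \<open>B\<close> and
  contains all commutators of \<open>B\<close>. Either it is already the nil part of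
  \<open>B\<close>, or some \<open>z\<close> outside \<open>I\<close> has its square in
  \<open>N\<close>, and then adding the line through \<open>z\<close> gives the nil part of
  \<open>B\<close>.\<close>

lemma nil_ideal_codim_1:
  assumes B: "subalgebra B" and I: "ideal_of I B" "has_codim I B 1" and nI: "nil_ideal I"
  shows "nil_ideal B"
proof -
  note sB = subalgebraD[OF B] and sI = ideal_ofD[OF I(1)]
  define N where "N = {z \<in> I. nil z}"
  have idN: "ideal_of N I" and commI: "\<And>x y. x \<in> I \<Longrightarrow> y \<in> I \<Longrightarrow> x * y - y * x \<in> N"
    using nI sI by (auto simp: nil_ideal_def N_def subspace_diff)
  note sN = ideal_ofD[OF idN]
  have red: "z \<in> N" if "z \<in> I" "z * z \<in> N" for z
    using that nil_square by (auto simp: N_def)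
  \<comment> \<open>The squares of \<open>b * n\<close> and \<open>n * b\<close> are multiples of
    \<open>n\<close> by \<open>b * n * b\<close>, which lies in \<open>I\<close>; so they are in
    \<open>N\<close>, and \<open>red\<close> extracts the root.\<close>
  have NB: "b * n \<in> N \<and> n * b \<in> N" if b: "b \<in> B" and n: "n \<in> N" for b n
  proof -
    have nI: "n \<in> I" using n sN by blast
    have "(b * n) * (b * n) = (b * n * b) * n" "(n * b) * (n * b) = n * (b * n * b)"
      by (simp_all add: mult.assoc)
    moreover have bnb: "b * n * b \<in> I" using sI(4)[OF b sI(3)[OF b nI]] .
    ultimately show ?thesis
      using red[OF sI(3)[OF b nI]] red[OF sI(4)[OF b nI]] sN(3)[OF bnb n] sN(4)[OF bnb n] by simp
  qed
  have idNB: "ideal_of N B" using NB sN sI by (auto simp: ideal_of_def)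
  have commIB: "r * j - j * r \<in> N" if r: "r \<in> B" and j: "j \<in> I" for r j
  proof -
    let ?d = "r * j - j * r"
    have d: "?d \<in> I" using subspace_diff[OF sI(1) sI(3)[OF r j] sI(4)[OF r j]] .
    \<comment> \<open>Since \<open>k * r\<close> is again in \<open>I\<close>, commutators inside
      \<open>I\<close> suffice here. Taking \<open>k\<close> to be \<open>?d\<close> itself then
      puts its square in \<open>N\<close>.\<close>
    have "k * ?d \<in> N" if k: "k \<in> I" for k
    proof -
      have "k * ?d = ((k * r) * j - j * (k * r)) + (j * k - k * j) * r"
        by (simp add: algebra_simps)
      moreover have "(k * r) * j - j * (k * r) \<in> N" using commI[OF sI(4)[OF r k] j] .
      moreover have "(j * k - k * j) * r \<in> N" using NB[OF r commI[OF j k]] by simp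
      ultimately show ?thesis using sN(1) by (simp add: subspace_add)
    qed
    then show ?thesis using red d by blast
  qed
  obtain v where v: "v \<in> B" "v \<notin> I" using codim_1E[OF I(1) sB(1) I(2)] by blast
  have comm: "x * y - y * x \<in> N" if x: "x \<in> B" and y: "y \<in> B" for x y
  proof -
    obtain a i where x: "i \<in> I" "x = i + a *s v"
      using codim_1_complement[OF I(1) sB(1) I(2) v x] by blast
    obtain b j where y: "j \<in> I" "y = j + b *s v"
      using codim_1_complement[OF I(1) sB(1) I(2) v y] by blast
    \<comment> \<open>The multiples of \<open>v\<close> commute with each other, so every remaining
      commutator involves an element of \<open>I\<close>.\<close>
    have "x * y - y * x = (i * j - j * i) - b *s (v * i - i * v) + a *s (v * j - j * v)"
      unfolding x y by (simp add: algebra_simps scale_mult_left scale_mult_right scale_left_commute)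
    then show ?thesis using commI[OF x(1) y(1)] commIB[OF v(1) x(1)] commIB[OF v(1) y(1)]
      by (simp add: subspace_add subspace_diff subspace_scale sN(1))
  qed
  show ?thesis
  proof (cases "\<forall>z\<in>B. z * z \<in> N \<longrightarrow> z \<in> N")
    case True
    then show ?thesis using nil_idealI[OF B idNB] comm by (auto simp: N_def)
  next
    case False
    then obtain z where z: "z \<in> B" "z * z \<in> N" "z \<notin> N" by blast
    then have zI: "z \<notin> I" using red by blast
    have zi: "z * i \<in> N \<and> i * z \<in> N" if i: "i \<in> I" for i
    proof -
      have ziI: "z * i \<in> I" "i * z \<in> I" using sI(3,4)[OF z(1) i] .
      \<comment> \<open>Swapping the inner \<open>z * i\<close> costs only a commutator in
        \<open>N\<close> and produces the factor \<open>z * z\<close>, also in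
        \<open>N\<close>.\<close>
      have "(i * z) * (i * z) = i * (z * i - i * z) * z + (i * i) * (z * z)"
        by (simp add: algebra_simps)
      moreover have "i * (z * i - i * z) * z \<in> N" "(i * i) * (z * z) \<in> N"
        using NB[OF z(1)] NB[of "i * i"] z(2) NB[OF _ commIB[OF z(1) i]] sI(2,3) i z(1)
        by (simp_all add: subset_iff)
      ultimately have "i * z \<in> N" using red[OF ziI(2)] by (simp add: subspace_add[OF sN(1)])
      moreover have "z * i - i * z \<in> N" using commIB[OF z(1) i] .
      ultimately show ?thesis using subspace_add[OF sN(1), of "z * i - i * z" "i * z"] by simp
    qed
    \<comment> \<open>The candidate for the nil part of \<open>B\<close>: modulo \<open>N\<close>,
      the element \<open>z\<close> annihilates all of \<open>B\<close> on both sides, so this span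
      is an ideal.\<close>
    define M where "M = span (insert z N)"
    have M: "w \<in> M \<longleftrightarrow> (\<exists>c. w - c *s z \<in> N)" for w
      unfolding M_def span_insert span_eq_iff[THEN iffD2, OF sN(1)] by simp
    have NM: "N \<subseteq> M" unfolding M_def using span_superset[of "insert z N"] by blast
    have Bz: "b * z \<in> N \<and> z * b \<in> N" if b: "b \<in> B" for b
    proof -
      obtain a i where x: "i \<in> I" "b = i + a *s z"
        using codim_1_complement[OF I(1) sB(1) I(2) z(1) zI b] by blast
      show ?thesis unfolding x(2) using zi[OF x(1)] z(2)
        by (simp add: distrib_left distrib_right scale_mult_left scale_mult_right
            subspace_add subspace_scale sN(1))
    qed
    have MB: "b * w \<in> N \<and> w * b \<in> N" if b: "b \<in> B" and w: "w \<in> M" for b w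
    proof -
      obtain c where c: "w - c *s z \<in> N" using w M by blast
      have "b * w = b * (w - c *s z) + c *s (b * z)" "w * b = (w - c *s z) * b + c *s (z * b)"
        by (simp_all add: algebra_simps scale_mult_left scale_mult_right)
      then show ?thesis using NB[OF b c] Bz[OF b] by (simp add: subspace_add subspace_scale sN(1))
    qed
    have MsB: "M \<subseteq> B" unfolding M_def using z(1) sN(2) sI(2) sB(1) by (intro span_minimal) auto
    have "ideal_of M B" using MB MsB NM by (auto simp: ideal_of_def M_def)
    moreover have "nil w" if "w \<in> M" for w
      using MB[of w w] MsB that nil_square by (auto simp: N_def)
    \<comment> \<open>With \<open>w = i + a *s z\<close>, the square of \<open>w\<close> is
      congruent to \<open>i * i\<close> modulo \<open>N\<close>, but also to some
      \<open>c *s z\<close>. As \<open>z\<close> is outside \<open>I\<close>, this forces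
      \<open>c = 0\<close>, so \<open>i * i\<close> and then \<open>i\<close> are in
      \<open>N\<close>.\<close>
    moreover have "w \<in> M" if w: "w \<in> B" "w * w \<in> M" for w
    proof -
      obtain a i where x: "i \<in> I" "w = i + a *s z"
        using codim_1_complement[OF I(1) sB(1) I(2) z(1) zI w(1)] by blast
      obtain c where c: "w * w - c *s z \<in> N" using w M by blast
      have zz: "w * w - i * i \<in> N"
      proof -
        have "w * w - i * i = a *s (i * z) + a *s (z * w)"
          unfolding x(2) by (simp add: algebra_simps scale_mult_left scale_mult_right)
        then show ?thesis using zi[OF x(1)] Bz[OF w(1)] by (simp add: subspace_add subspace_scale sN(1))
      qed
      have "c *s z - i * i \<in> N"
        using subspace_diff[OF sN(1) zz c] by simp
      then have "c *s z \<in> I" using subspace_add[OF sI(1), of "c *s z - i * i" "i * i"] sN(2) sI(2) sI(3)[OF _ x(1)] x(1) by (auto simp: subset_iff)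
      then have "c = 0"
        using zI subspace_scale[OF sI(1), of "c *s z" "inverse c"] by (cases "c = 0") auto
      then have "i * i \<in> N" using c subspace_diff[OF sN(1) c zz] by simp
      then have "i \<in> N" using red[OF x(1)] by blast
      then show ?thesis unfolding M x by (intro exI[of _ a]) simp
    qed
    ultimately show ?thesis using nil_idealI[OF B, of M] comm NM by blast
  qed
qed

section \<open>Nil algebras and domains with such chains\<close>

text \<open>The quotient is a line spanned by \<open>v\<close> with \<open>v * v\<close> congruent
  to \<open>a *s v\<close>. If \<open>a\<close> were nonzero, no nonzero multiple of
  \<open>v\<close> could be nilpotent in the quotient, so \<open>a = 0\<close> and all products
  vanish there.\<close>

lemma nil_square_in_codim_1:
  assumes B: "subalgebra B" and I: "ideal_of I B" "has_codim I B 1"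
    and nil: "\<And>z. z \<in> B \<Longrightarrow> nil z" and x: "x \<in> B" and y: "y \<in> B"
  shows "x * y \<in> I"
proof -
  note sB = subalgebraD[OF B] and sI = ideal_ofD[OF I(1)]
  obtain v where v: "v \<in> B" "v \<notin> I" using codim_1E[OF I(1) sB(1) I(2)] by blast
  obtain a where a: "v * v - a *s v \<in> I"
    using codim_1_complement[OF I(1) sB(1) I(2) v sB(2)[OF v(1) v(1)]] by (metis add_diff_cancel_right')
  have a0: "a = 0"
  proof (rule ccontr)
    assume a0: "a \<noteq> 0"
    \<comment> \<open>Squaring turns the coefficient \<open>b\<close> into \<open>b * b * a\<close>,
      so its vanishing passes back from \<open>w * w\<close> to \<open>w\<close>. The contradiction
      comes from \<open>v\<close> itself, whose coefficient is 1.\<close>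
    have "\<forall>b i. i \<in> I \<and> w = i + b *s v \<longrightarrow> b = 0" if "nil w" for w
      using that
    proof induction
      case nil_zero
      have "b = 0" if "i \<in> I" "0 = i + b *s v" for b i
      proof (rule ccontr)
        assume "b \<noteq> 0"
        have "b *s v = - i" using that(2) by (metis add_eq_0_iff)
        then have "b *s v \<in> I" using that subspace_neg[OF sI(1)] by simp
        then show False using v(2) \<open>b \<noteq> 0\<close> subspace_scale[OF sI(1), of "b *s v" "inverse b"] by simp
      qed
      then show ?case by blast
    next
      case (nil_square w)
      have "b = 0" if w: "i \<in> I" "w = i + b *s v" for b i
      proof -
        have "w * w = (i * w + b *s (v * i) + (b * b) *s (v * v - a *s v)) + (b * b * a) *s v"
          unfolding w(2) by (simp add: algebra_simps scale_mult_left scale_mult_right)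
        moreover have "w \<in> B" unfolding w(2) using w(1) v(1) sI(2)
          by (auto intro!: subspace_add subspace_scale sB(1))
        then have "i * w + b *s (v * i) + (b * b) *s (v * v - a *s v) \<in> I"
          using sI(4)[OF _ w(1)] sI(3)[OF v(1) w(1)] a by (simp add: subspace_add subspace_scale sI(1))
        ultimately have "b * b * a = 0" using nil_square.IH by blast
        then show ?thesis using a0 by simp
      qed
      then show ?case by blast
    qed
    from this[OF nil[OF v(1)]] show False
      using subspace_0[OF sI(1)] by (metis add.left_neutral scale_one zero_neq_one)
  qed
  then have vv: "v * v \<in> I" using a by simp
  obtain b i where xi: "i \<in> I" "x = i + b *s v"
    using codim_1_complement[OF I(1) sB(1) I(2) v x] by blast
  obtain c j where yj: "j \<in> I" "y = j + c *s v"
    using codim_1_complement[OF I(1) sB(1) I(2) v y] by blast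
  have "x * y = i * y + b *s (v * j) + (b * c) *s (v * v)"
    unfolding xi yj by (simp add: algebra_simps scale_mult_left scale_mult_right)
  then show ?thesis using sI(4)[OF y xi(1)] sI(3)[OF v(1) yj(1)] vv
    by (simp add: subspace_add subspace_scale sI(1))
qed

text \<open>If \<open>I\<close> has codimension 1 in the nil algebra \<open>B\<close>, then \<open>BB \<subseteq> I\<close>, so \<open>L \<subseteq> BL\<close> improves to
  \<open>L \<subseteq> BBL \<subseteq> IL\<close>.\<close>

lemma no_nil_multiplicative_space:
  assumes B: "subalgebra B" "finite_dim B"
    and triv: "\<And>C. subalgebra C \<Longrightarrow> finite_dim C \<Longrightarrow> one_perfect C \<Longrightarrow> C \<subseteq> {0}"
    and nil: "\<And>z::'a. nil z"
    and L: "L \<subseteq> span {b * l |b l. b \<in> B \<and> l \<in> L}"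
  shows "L \<subseteq> {0}"
  using B L
proof (induction rule: finite_dim_codim_1_induct)
  case (perfect B)
  then have "B \<subseteq> {0}" using triv by simp
  then have "{b * l |b l. b \<in> B \<and> l \<in> L} \<subseteq> {0}" by auto
  then have "span {b * l |b l. b \<in> B \<and> l \<in> L} \<subseteq> {0}"
    by (rule span_minimal) (rule subspace_single_0)
  then show ?case using perfect.prems by simp
next
  case (step B I)
  let ?BL = "{b * l |b l. b \<in> B \<and> l \<in> L}" and ?IL = "{b * l |b l. b \<in> I \<and> l \<in> L}"
  have BI: "x * y \<in> I" if "x \<in> B" "y \<in> B" for x y
    by (rule nil_square_in_codim_1[OF step.hyps(1,3,4) nil that])
  have "b * l \<in> span ?IL" if b: "b \<in> B" and l: "l \<in> L" for b l
  proof -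
    have "l \<in> span ?BL" using step.prems l by blast
    then show ?thesis
    proof (induction rule: span_induct_alt)
      case base
      then show ?case by (simp add: span_zero)
    next
      case (step c x y)
      then obtain d m where x: "x = d * m" "d \<in> B" "m \<in> L" by blast
      then have "b * x \<in> ?IL" using BI[OF b] by (auto simp: mult.assoc[symmetric])
      then show ?case using step.IH
        by (simp add: distrib_left scale_mult_right span_add span_scale span_base)
    qed
  qed
  then have "span ?BL \<subseteq> span ?IL" by (intro span_minimal) auto
  then show ?case using step.IH step.prems by simp
qed

text \<open>If the ideal \<open>I\<close> contains some \<open>y \<noteq> 0\<close>, then by
  induction it is the line through \<open>y\<close>. Both \<open>y * v\<close> and
  \<open>y * y\<close> are multiples of \<open>y\<close>, and cancelling \<open>y\<close> puts
  \<open>v\<close> into \<open>I\<close>. Hence \<open>I\<close> is zero and \<open>B\<close> is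
  spanned by \<open>v\<close>.\<close>

lemma commutative_domain_line:
  assumes B: "subalgebra B" "finite_dim B"
    and triv: "\<And>C. subalgebra C \<Longrightarrow> finite_dim C \<Longrightarrow> one_perfect C \<Longrightarrow> C \<subseteq> {0}"
    and dom: "\<And>x y::'a. x * y = 0 \<Longrightarrow> x = 0 \<or> y = 0"
  shows "\<exists>w. B \<subseteq> span {w}"
  using B
proof (induction rule: finite_dim_codim_1_induct)
  case (perfect B)
  then have "B \<subseteq> {0}" using triv by simp
  then show ?case using span_superset[of "{0}"] by blast
next
  case (step B I)
  note sB = subalgebraD[OF step.hyps(1)] and sI = ideal_ofD[OF step.hyps(3)]
  obtain w where w: "I \<subseteq> span {w}" using step.IH by blast
  obtain v where v: "v \<in> B" "v \<notin> I" using codim_1E[OF step.hyps(3) sB(1) step.hyps(4)] by blast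
  have "I \<subseteq> {0}"
  proof (rule ccontr)
    assume "\<not> I \<subseteq> {0}"
    then obtain y where y: "y \<in> I" "y \<noteq> 0" by blast
    have line: "\<exists>k. z = k *s w" if "z \<in> I" for z
      using that w by (auto simp: span_singleton)
    obtain a where a: "y = a *s w" using line[OF y(1)] by blast
    obtain c where c: "y * v = c *s w" using line[OF sI(4)[OF v(1) y(1)]] by blast
    have "a \<noteq> 0" using a y by auto
    then have "y * v = (c / a) *s y" using a c by simp
    moreover have "y * y \<in> I" using sI(2,3) y by blast
    then obtain d where d: "y * y = d *s w" using line by blast
    have yy: "y * y = (d / a) *s y" using a d \<open>a \<noteq> 0\<close> by simp
    ultimately have "y * ((d / a) *s v - (c / a) *s y) = 0"
      by (simp add: right_diff_distrib scale_mult_right scale_left_commute)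
    then have eq: "(d / a) *s v = (c / a) *s y" using dom y(2) by fastforce
    have "d / a \<noteq> 0" using yy y(2) dom[of y y] by auto
    then have "v = inverse (d / a) *s ((d / a) *s v)" by simp
    then have "v = inverse (d / a) *s ((c / a) *s y)" using eq by simp
    then have "v \<in> I" using y(1) sI(1) by (metis subspace_scale)
    then show False using v by simp
  qed
  have "x \<in> span {v}" if x: "x \<in> B" for x
  proof -
    obtain c i where i: "i \<in> I" "x = i + c *s v"
      using codim_1_complement[OF step.hyps(3) sB(1) step.hyps(4) v x] .
    then have "i = 0" using \<open>I \<subseteq> {0}\<close> by blast
    then show ?thesis using i(2) by (simp add: span_base span_scale)
  qed
  then show ?case by blast
qed

end

section \<open>The union of the 1-perfect subalgebras of a simple locally finite algebra\<close>

locale simple_locally_finite_algebra = assoc_algebra scale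
  for scale :: "'k::field \<Rightarrow> 'a::ring \<Rightarrow> 'a" (infixr \<open>*s\<close> 75) +
  assumes simple: "simple_algebra UNIV"
    and loc_fin: "locally_finite UNIV"
begin

lemma ideal_trivial: "ideal_of I UNIV \<Longrightarrow> I = {0} \<or> I = UNIV"
  using simple by (simp add: simple_algebra_def)

lemma finite_subset_subalgebra:
  assumes "finite X"
  obtains B where "subalgebra B" "finite_dim B" "X \<subseteq> B"
  using loc_fin assms unfolding locally_finite_def by blast

lemma finite_dim_pair_subalgebra:
  assumes "finite_dim C" "finite_dim D"
  obtains B where "subalgebra B" "finite_dim B" "C \<subseteq> B" "D \<subseteq> B"
proof -
  obtain S T where ST: "finite S" "span S = C" "finite T" "span T = D"
    using assms by (auto simp: finite_dim_def)
  then obtain B where B: "subalgebra B" "finite_dim B" "S \<union> T \<subseteq> B"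
    using finite_subset_subalgebra[of "S \<union> T"] by auto
  then have "C \<subseteq> B" "D \<subseteq> B" using ST subalgebraD(1)[OF B(1)] span_minimal[of _ B] by auto
  then show thesis using that B by blast
qed

text \<open>This is the local system that witnesses the theorem.\<close>

definition perfect_subalgebras :: "'a set set" where
  "perfect_subalgebras = {C. subalgebra C \<and> finite_dim C \<and> one_perfect C}"

text \<open>Take \<open>E\<close> to be the greatest 1-perfect subalgebra of a finite dimensional
  \<open>B\<close> that contains \<open>C\<close>, \<open>D\<close> and \<open>X\<close>. The set
  \<open>X\<close> allows multiplication by arbitrary elements of the algebra to be tested inside
  such a \<open>B\<close>.\<close>

lemma perfect_subalgebras_directed:
  assumes "C \<in> perfect_subalgebras" "D \<in> perfect_subalgebras" "finite X"
  obtains B E where "subalgebra B" "X \<subseteq> B" "E \<in> perfect_subalgebras" "C \<subseteq> E" "D \<subseteq> E" "ideal_of E B"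
proof -
  obtain F where F: "subalgebra F" "finite_dim F" "X \<subseteq> F"
    using finite_subset_subalgebra[OF assms(3)] .
  obtain G where G: "subalgebra G" "finite_dim G" "C \<subseteq> G" "D \<subseteq> G"
    using finite_dim_pair_subalgebra[of C D] assms by (auto simp: perfect_subalgebras_def)
  obtain B where B: "subalgebra B" "finite_dim B" "F \<subseteq> B" "G \<subseteq> B"
    using finite_dim_pair_subalgebra[OF F(2) G(2)] .
  obtain E where E: "ideal_of E B" "finite_dim E" "one_perfect E"
    "\<And>C. C \<subseteq> B \<Longrightarrow> subalgebra C \<Longrightarrow> one_perfect C \<Longrightarrow> C \<subseteq> E"
    using greatest_one_perfect[OF B(1,2)] by blast
  have "C \<subseteq> E" "D \<subseteq> E" using E(4) B G assms by (auto simp: perfect_subalgebras_def)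
  moreover have "E \<in> perfect_subalgebras"
    using E(2,3) ideal_imp_subalgebra[OF E(1)] by (simp add: perfect_subalgebras_def)
  ultimately show thesis using that B(1,3) F(3) E(1) by blast
qed

lemma ideal_Union_perfect: "ideal_of (\<Union>perfect_subalgebras) UNIV"
proof -
  let ?U = "\<Union>perfect_subalgebras"
  \<comment> \<open>The zero algebra has no subspace of codimension 1, so the family is never
    empty.\<close>
  have "{0} \<in> perfect_subalgebras"
  proof -
    have "\<not> has_codim I {0} 1" if "ideal_of I {0}" for I
      using codim_1E[OF that subspace_single_0] subspace_0[OF ideal_ofD(1)[OF that]]
      by (metis singletonD)
    moreover have "finite_dim {0}" unfolding finite_dim_def
      by (intro exI[of _ "{}"]) (simp add: independent_empty)
    ultimately show ?thesis
      by (auto simp: perfect_subalgebras_def one_perfect_def subalgebra_def subspace_single_0)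
  qed
  then have "0 \<in> ?U" by blast
  moreover have "x + y \<in> ?U" if xy: "x \<in> ?U" "y \<in> ?U" for x y
  proof -
    obtain C D where CD: "C \<in> perfect_subalgebras" "x \<in> C" "D \<in> perfect_subalgebras" "y \<in> D"
      using xy by blast
    obtain B E where "subalgebra B" "{} \<subseteq> B"
      and E: "E \<in> perfect_subalgebras" "C \<subseteq> E" "D \<subseteq> E" "ideal_of E B"
      using perfect_subalgebras_directed[OF CD(1,3) finite.emptyI] .
    then have "x \<in> E" "y \<in> E" using CD by auto
    then have "x + y \<in> E" by (rule subspace_add[OF ideal_ofD(1)[OF E(4)]])
    then show ?thesis using E by blast
  qed
  moreover have "c *s x \<in> ?U \<and> b * x \<in> ?U \<and> x * b \<in> ?U" if x: "x \<in> ?U" for x b c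
  proof -
    obtain C where C: "C \<in> perfect_subalgebras" "x \<in> C" using x by blast
    obtain B E where E: "subalgebra B" "{b} \<subseteq> B" "E \<in> perfect_subalgebras" "C \<subseteq> E" "C \<subseteq> E" "ideal_of E B"
      by (rule perfect_subalgebras_directed[OF C(1) C(1), of "{b}"]) simp
    then have "x \<in> E" "b \<in> B" using C by auto
    then have "c *s x \<in> E \<and> b * x \<in> E \<and> x * b \<in> E"
      using subspace_scale[OF ideal_ofD(1)[OF E(6)], of x c] ideal_ofD(3,4)[OF E(6), of b x] by simp
    then show ?thesis using E by blast
  qed
  ultimately show ?thesis by (simp add: ideal_of_def subspace_def)
qed

lemma one_perfect_local_system_perfect:
  assumes "\<Union>perfect_subalgebras = UNIV"
  shows "one_perfect_local_system perfect_subalgebras UNIV"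
proof -
  have "\<exists>E\<in>perfect_subalgebras. C \<subseteq> E \<and> D \<subseteq> E"
    if "C \<in> perfect_subalgebras" "D \<in> perfect_subalgebras" for C D
    by (rule perfect_subalgebras_directed[OF that finite.emptyI]) blast
  then show ?thesis using assms
    by (auto simp: one_perfect_local_system_def local_system_def perfect_subalgebras_def)
qed

section \<open>Annihilators and two-sided multiples\<close>

text \<open>A linear combination involves only finitely many factors \<open>a\<close> and
  \<open>b\<close>. Local finiteness can then place them all in one finite dimensional
  subalgebra.\<close>

lemma finite_sum_in_subalgebra:
  assumes "x \<in> span {a * y * b |a b. True}"
  shows "\<exists>X. finite X \<and> x \<in> span {a * y * b |a b. a \<in> X \<and> b \<in> X}"
  using assms
proof (induction rule: span_induct_alt)
  case base
  then show ?case using span_zero by blast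
next
  case (step c z t)
  obtain a b where z: "z = a * y * b" using step by blast
  obtain X where X: "finite X" "t \<in> span {a * y * b |a b. a \<in> X \<and> b \<in> X}" using step by blast
  let ?X = "insert a (insert b X)"
  let ?S = "{a * y * b |a b. a \<in> ?X \<and> b \<in> ?X}"
  have "t \<in> span ?S" using X(2) span_mono[of "{a * y * b |a b. a \<in> X \<and> b \<in> X}" ?S] by blast
  moreover have "z \<in> span ?S" unfolding z by (rule span_base) blast
  ultimately have "c *s z + t \<in> span ?S" by (simp add: span_add span_scale)
  then show ?case using X(1) by (intro exI[of _ ?X]) simp
qed

lemma ideal_of_UNIV_I:
  assumes "subspace I" "\<And>b x. x \<in> I \<Longrightarrow> b * x \<in> I \<and> x * b \<in> I"
  shows "ideal_of I UNIV"
  using assms by (simp add: ideal_of_def)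

text \<open>Such elements form an ideal, which is proper because a simple algebra has a nonzero
  product.\<close>

lemma left_annihilator_trivial:
  fixes x :: 'a
  assumes "\<And>y. x * y = 0"
  shows "x = 0"
proof -
  let ?I = "{x::'a. \<forall>y. x * y = 0}"
  have "ideal_of ?I UNIV"
    by (rule ideal_of_UNIV_I)
      (auto simp: subspace_def distrib_right scale_mult_left mult.assoc)
  moreover have "?I \<noteq> UNIV" using simple unfolding simple_algebra_def by blast
  ultimately have "?I = {0}" using ideal_trivial by blast
  then show ?thesis using assms by blast
qed

lemma right_annihilator_trivial:
  fixes x :: 'a
  assumes "\<And>y. y * x = 0"
  shows "x = 0"
proof -
  let ?I = "{x::'a. \<forall>y. y * x = 0}"
  have "ideal_of ?I UNIV"
    by (rule ideal_of_UNIV_I)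
      (auto simp: subspace_def distrib_left scale_mult_right mult.assoc[symmetric])
  moreover have "?I \<noteq> UNIV" using simple unfolding simple_algebra_def by blast
  ultimately have "?I = {0}" using ideal_trivial by blast
  then show ?thesis using assms by blast
qed

text \<open>The span is an ideal. It is not zero, since otherwise the two annihilator lemmas,
  applied one after the other, would give \<open>x = 0\<close>.\<close>

lemma two_sided_span_UNIV:
  assumes "x \<noteq> 0"
  shows "span {a * x * b |a b. True} = UNIV" (is "span ?S = _")
proof -
  have "b * z \<in> span ?S \<and> z * b \<in> span ?S" if "z \<in> span ?S" for z b
    using that
  proof (induction rule: span_induct_alt)
    case base
    then show ?case by (simp add: span_zero)
  next
    case (step c z y)
    then obtain p q where z: "z = p * x * q" by blast
    have "b * z = (b * p) * x * q" "z * b = p * x * (q * b)" unfolding z by (simp_all add: mult.assoc)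
    then have "b * z \<in> span ?S" "z * b \<in> span ?S" by (metis (mono_tags, lifting) mem_Collect_eq span_base)+
    then show ?case using step.IH
      by (simp add: distrib_left distrib_right scale_mult_left scale_mult_right span_add span_scale)
  qed
  then have "span ?S = {0} \<or> span ?S = UNIV"
    using ideal_trivial[OF ideal_of_UNIV_I[OF subspace_span]] by blast
  moreover have "span ?S \<noteq> {0}"
  proof
    assume "span ?S = {0}"
    then have "a * x * b = 0" for a b using span_base[of "a * x * b" ?S] by blast
    then show False using assms left_annihilator_trivial right_annihilator_trivial by metis
  qed
  ultimately show ?thesis by blast
qed

section \<open>The case where no nonzero finite dimensional subalgebra is 1-perfect\<close>

context
  assumes no_perfect: "\<And>C. subalgebra C \<Longrightarrow> finite_dim C \<Longrightarrow> one_perfect C \<Longrightarrow> C \<subseteq> {0}"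
begin

lemma finite_dim_nil_ideal:
  assumes "subalgebra B" "finite_dim B"
  shows "nil_ideal B"
  using assms
proof (induction rule: finite_dim_codim_1_induct)
  case (perfect B)
  then have "B = {0}" using no_perfect subspace_0[OF subalgebraD(1)] by blast
  then show ?case by (auto simp: nil_ideal_def ideal_of_def subspace_def nil_zero)
next
  case (step B I)
  then show ?case using nil_ideal_codim_1 by blast
qed

text \<open>Each closure property involves at most two elements, so it is inherited from a finite
  dimensional subalgebra containing them.\<close>

lemma ideal_nil: "ideal_of {z::'a. nil z} UNIV"
proof (rule ideal_of_UNIV_I)
  have "x + y \<in> {z. nil z} \<and> c *s x \<in> {z. nil z}" if "nil x" "nil y" for x y :: 'a and c
  proof -
    obtain B where B: "subalgebra B" "finite_dim B" "{x, y} \<subseteq> B"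
      using finite_subset_subalgebra[of "{x, y}"] by blast
    then have "subspace {z \<in> B. nil z}"
      using finite_dim_nil_ideal by (simp add: nil_ideal_def ideal_of_def)
    then show ?thesis using that B(3) subspace_add[of "{z \<in> B. nil z}" x y]
        subspace_scale[of "{z \<in> B. nil z}" x c] by auto
  qed
  then show "subspace {z::'a. nil z}" by (auto simp: subspace_def nil_zero)
next
  fix b x :: 'a assume x: "x \<in> {z. nil z}"
  obtain B where B: "subalgebra B" "finite_dim B" "{x, b} \<subseteq> B"
    using finite_subset_subalgebra[of "{x, b}"] by blast
  then have "ideal_of {z \<in> B. nil z} B" using finite_dim_nil_ideal by (simp add: nil_ideal_def)
  then show "b * x \<in> {z. nil z} \<and> x * b \<in> {z. nil z}"
    using ideal_ofD(3,4)[of "{z \<in> B. nil z}" B b x] x B(3) by auto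
qed

lemma nil_commutator:
  fixes x y :: 'a
  shows "nil (x * y - y * x)"
proof -
  obtain B where "subalgebra B" "finite_dim B" "{x, y} \<subseteq> B"
    using finite_subset_subalgebra[of "{x, y}"] by blast
  then show ?thesis using finite_dim_nil_ideal by (simp add: nil_ideal_def)
qed

lemma not_all_nil: "\<exists>z::'a. \<not> nil z"
proof (rule ccontr)
  assume "\<nexists>z::'a. \<not> nil z"
  then have nil: "nil z" for z :: 'a by blast
  obtain x :: 'a where x: "x \<noteq> 0" using simple by (auto simp: simple_algebra_def)
  obtain X where X: "finite X" "x \<in> span {a * x * b |a b. a \<in> X \<and> b \<in> X}"
    using finite_sum_in_subalgebra[of x x] two_sided_span_UNIV[OF x] by auto
  obtain B where B: "subalgebra B" "finite_dim B" "X \<subseteq> B"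
    using finite_subset_subalgebra[OF X(1)] .
  \<comment> \<open>Right multiples absorb the right-hand factors of \<open>x\<close>, written as a
    combination of products \<open>a * x * b\<close>, so only left factors from \<open>B\<close>
    remain. Without an identity element, \<open>x\<close> must be added separately.\<close>
  define L where "L = insert x {x * b |b. b \<in> B}"
  let ?BL = "{b * l |b l. b \<in> B \<and> l \<in> L}"
  have sub: "{a * x * b |a b. a \<in> X \<and> b \<in> X} \<subseteq> ?BL"
    using B(3) unfolding L_def by (force simp: mult.assoc)
  then have "x \<in> span ?BL" using X(2) span_mono by blast
  moreover have "x * w \<in> span ?BL" if w: "w \<in> B" for w
    using X(2)
  proof (induction rule: span_induct_alt)
    case base
    then show ?case by (simp add: span_zero)
  next
    case (step c z y)
    then obtain a b where z: "z = a * x * b" "a \<in> B" "b \<in> B" using B(3) by blast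
    have "b * w \<in> B" using subalgebraD(2)[OF B(1) z(3) w] .
    then have "a * (x * (b * w)) \<in> ?BL" using z(2) unfolding L_def by blast
    then have "z * w \<in> span ?BL" unfolding z by (simp add: span_base mult.assoc)
    then show ?case using step.IH
      by (simp add: distrib_right scale_mult_left span_add span_scale)
  qed
  ultimately have "L \<subseteq> span ?BL" unfolding L_def by blast
  then have "L \<subseteq> {0}" using no_nil_multiplicative_space[OF B(1,2) no_perfect nil] by blast
  then show False using x unfolding L_def by simp
qed

text \<open>By simplicity and \<open>not_all_nil\<close>, zero is the only nil element. So
  commutators vanish, the annihilator of an element is an ideal, and the algebra is a domain to
  which \<open>commutative_domain_line\<close> applies.\<close>

lemma all_in_line:
  fixes s t :: 'a
  shows "\<exists>w. {s, t} \<subseteq> span {w}"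
proof -
  have "{z::'a. nil z} = {0}" using ideal_trivial[OF ideal_nil] not_all_nil by blast
  then have "x * y - y * x = 0" for x y :: 'a using nil_commutator[of x y] by blast
  then have comm: "x * y = y * x" for x y :: 'a by (metis eq_iff_diff_eq_0)
  have dom: "x = 0 \<or> y = 0" if "x * y = 0" for x y :: 'a
  proof -
    have "x * (b * z) = 0 \<and> x * (z * b) = 0" if "x * z = 0" for b z
      using that comm[of b z] by (simp add: mult.assoc[symmetric])
    then have "ideal_of {y. x * y = 0} UNIV"
      by (intro ideal_of_UNIV_I) (auto simp: subspace_def distrib_left scale_mult_right)
    then have "{y. x * y = 0} = {0} \<or> {y. x * y = 0} = UNIV" by (rule ideal_trivial)
    then show ?thesis using that left_annihilator_trivial by blast
  qed
  obtain B where B: "subalgebra B" "finite_dim B" "{s, t} \<subseteq> B"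
    using finite_subset_subalgebra[of "{s, t}"] by blast
  then show ?thesis using commutative_domain_line[OF B(1,2) no_perfect dom] by blast
qed

end

text \<open>If the union were zero, any two elements would lie on a common line, whereas
  \<open>S\<close> supplies two independent ones.\<close>

lemma Union_perfect_UNIV:
  assumes "infinite S" "independent S"
  shows "\<Union>perfect_subalgebras = UNIV"
proof (rule ccontr)
  assume "\<Union>perfect_subalgebras \<noteq> UNIV"
  then have "\<Union>perfect_subalgebras = {0}" using ideal_trivial[OF ideal_Union_perfect] by blast
  then have triv: "C \<subseteq> {0}" if "subalgebra C" "finite_dim C" "one_perfect C" for C
    using that by (auto simp: perfect_subalgebras_def)
  obtain T where T: "T \<subseteq> S" "finite T" "card T = 2"
    using infinite_arbitrarily_large[OF assms(1)] by blast
  then obtain s t where st: "T = {s, t}" by (auto simp: card_2_iff)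
  obtain w where "T \<subseteq> span {w}" using all_in_line[OF triv, of s t] st by blast
  then have "card T \<le> card {w}"
    using independent_span_bound[of "{w}" T] independent_mono[OF assms(2) T(1)] by blast
  then show False using T by simp
qed

end

theorem theorem5p6:
  fixes scale :: "'k::alg_closed_field \<Rightarrow> 'a::ring \<Rightarrow> 'a"
  assumes "assoc_algebra scale"
    and "assoc_algebra.countably_infinite_dim scale (UNIV :: 'a set)"
    and "assoc_algebra.simple_algebra scale (UNIV :: 'a set)"
    and "assoc_algebra.locally_finite scale (UNIV :: 'a set)"
  shows "\<exists>\<C>. assoc_algebra.one_perfect_local_system scale \<C> (UNIV :: 'a set)"
proof -
  interpret simple_locally_finite_algebra scale
    using assms(1,3,4)
    by (simp add: simple_locally_finite_algebra_def simple_locally_finite_algebra_axioms_def)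
  obtain S where "infinite S" "independent S"
    using assms(2) by (auto simp: countably_infinite_dim_def)
  then show ?thesis using one_perfect_local_system_perfect[OF Union_perfect_UNIV] by blast
qed

end
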